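(* Let $$ G_1(x,\mathbf{p}) = \frac{1}{24} \sum_{n,m\ge1}\; \sum_{\substack{\alpha\vdash n\\ l(\alpha)=m}} \vert\mathcal{C}_\alpha\vert \left( \prod_{i=1}^m\frac{\alpha_i^{\alpha_i}}{(\alpha_i-1)!}\right) \left(n^m-n^{m-1}-\sum_{i=2}^m (i-2)!\,e_i(\alpha)\, n^{m-i}\right) \frac{x^n}{n!}\,p_\alpha . $$ Let $s=s(x,\mathbf{p})$ be the unique solution in $\mathbb{Q}[\mathbf{p}]\,[[x]]$ of the functional equation $s=x\,e^{\psi_0(s,\mathbf{p})}$, and write $\psi_i$ for $\psi_i(s,\mathbf{p})$, where $\psi_i(x,\mathbf{p})=\sum_{r\ge1}r^{i-1}a_rp_rx^r$ and $a_r=r^r/(r-1)!$. Then $$G_1(x,\mathbf{p})=\frac{1}{24}\log(1-\psi_1)^{-1}-\frac{1}{24}\psi_0.$$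
   Context: $\mathbf{p}=(p_1,p_2,\ldots)$ is a sequence of indeterminates and $x$ is an indeterminate; all series are formal power series. For a partition $\alpha=(\alpha_1,\ldots,\alpha_m)$, $p_\alpha=p_{\alpha_1}\cdots p_{\alpha_m}$, $l(\alpha)=m$ is the number of parts, $\alpha\vdash n$ means that $\alpha$ is a partition of $n$, $e_i(\alpha)$ is the $i$-th elementary symmetric function of $\alpha_1,\ldots,\alpha_m$, and $\mathcal{C}_\alpha$ is the conjugacy class of the symmetric group $\mathfrak{S}_n$ of permutations of cycle type $\alpha$. The expression $\log(1-\psi_1)^{-1}$ means $\log\frac{1}{1-\psi_1}=\sum_{k\ge1}\psi_1^k/k$. *)

theory Defs
  imports
    "HOL-Library.Poly_Mapping"
    "HOL-Library.Multiset"
    "HOL-Computational_Algebra.Formal_Power_Series"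
    "HOL-Combinatorics.Permutations"
    "HOL-Combinatorics.Orbits"
begin

text \<open>
  The polynomial ring over the rationals in the indeterminates \<open>p\<^sub>1, p\<^sub>2, \<dots>\<close>: finitely supported
  maps from monomials (finitely supported exponent vectors) to coefficients. The indeterminate
  \<open>p\<^sub>r\<close> with \<open>r \<ge> 1\<close> is the one at position \<open>r - 1\<close>, so the ring has no spurious \<open>p\<^sub>0\<close>;
  \<open>pvar\<close> is never used at \<open>0\<close>.
\<close>

type_synonym qp = "(nat \<Rightarrow>\<^sub>0 nat) \<Rightarrow>\<^sub>0 rat"

definition pvar :: "nat \<Rightarrow> qp" where
  "pvar r = Poly_Mapping.single (Poly_Mapping.single (r - 1) 1) 1"

definition qconst :: "rat \<Rightarrow> qp" where
  "qconst c = Poly_Mapping.single 0 c"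

text \<open>Partitions are weakly decreasing lists of positive integers.\<close>

definition is_partition :: "nat list \<Rightarrow> nat \<Rightarrow> bool" where
  "is_partition \<alpha> n \<longleftrightarrow> sorted_wrt (\<ge>) \<alpha> \<and> (\<forall>k\<in>set \<alpha>. k \<ge> 1) \<and> sum_list \<alpha> = n"

definition elem_sym :: "nat \<Rightarrow> nat list \<Rightarrow> nat" where
  "elem_sym i \<alpha> = (\<Sum>I | I \<subseteq> {..<length \<alpha>} \<and> card I = i. \<Prod>j\<in>I. \<alpha> ! j)"

definition p_part :: "nat list \<Rightarrow> qp" where
  "p_part \<alpha> = (\<Prod>j<length \<alpha>. pvar (\<alpha> ! j))"

text \<open>
  The multiset of cycle lengths of a permutation of \<open>{1..n}\<close>; fixed points are
  orbits of size one and so contribute parts equal to \<open>1\<close>.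
\<close>

definition cycle_type :: "nat \<Rightarrow> (nat \<Rightarrow> nat) \<Rightarrow> nat multiset" where
  "cycle_type n \<pi> = image_mset card (mset_set (orbit \<pi> ` {1..n}))"

definition conj_class :: "nat list \<Rightarrow> (nat \<Rightarrow> nat) set" where
  "conj_class \<alpha> = {\<pi>. \<pi> permutes {1..sum_list \<alpha>} \<and> cycle_type (sum_list \<alpha>) \<pi> = mset \<alpha>}"

definition a_coeff :: "nat \<Rightarrow> rat" where
  "a_coeff r = of_nat r ^ r / fact (r - 1)"

definition psi :: "nat \<Rightarrow> qp fps" where
  "psi i = Abs_fps (\<lambda>r. if r = 0 then 0
     else qconst (of_nat r powi (int i - 1) * a_coeff r) * pvar r)"

text \<open>
  The library series \<^const>\<open>fps_exp\<close> and \<^const>\<open>fps_ln\<close> require a field of coefficients, hence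
  separate definitions over the polynomial ring. Note that \<open>f oo g\<close> is the usual composition
  whenever \<open>g\<close> has zero constant term.
\<close>

definition exp_series :: "qp fps" where
  "exp_series = Abs_fps (\<lambda>k. qconst (1 / fact k))"

definition log_inv_series :: "qp fps" where
  "log_inv_series = Abs_fps (\<lambda>k. if k = 0 then 0 else qconst (1 / of_nat k))"

text \<open>
  The functional equation \<open>s = x exp (\<psi>\<^sub>0(s))\<close>. Its right-hand side is a multiple of \<open>x\<close>, so any
  solution has zero constant term and the inner composition is a genuine one.
\<close>

definition solves_functional_eq :: "qp fps \<Rightarrow> bool" where
  "solves_functional_eq s \<longleftrightarrow> s = fps_X * (exp_series oo (psi 0 oo s))"

definition G1_term :: "nat \<Rightarrow> nat list \<Rightarrow> rat" where
  "G1_term n \<alpha> =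
     (let m = length \<alpha> in
        of_nat (card (conj_class \<alpha>))
        * (\<Prod>j<m. of_nat (\<alpha> ! j) ^ (\<alpha> ! j) / fact (\<alpha> ! j - 1))
        * (of_nat n ^ m - of_nat n ^ (m - 1)
           - (\<Sum>i=2..m. fact (i - 2) * of_nat (elem_sym i \<alpha>) * of_nat n ^ (m - i)))
        / fact n)"

text \<open>
  The sums over \<open>m\<close> and over partitions with \<open>m\<close> parts are merged into one sum over nonempty
  partitions; for \<open>n = 0\<close> there are none.
\<close>

definition G1 :: "qp fps" where
  "G1 = Abs_fps (\<lambda>n. qconst (1 / 24) *
     (\<Sum>\<alpha> | is_partition \<alpha> n \<and> length \<alpha> \<ge> 1. qconst (G1_term n \<alpha>) * p_part \<alpha>))"

lemma finite_partitions: "finite {\<alpha>. is_partition \<alpha> n \<and> length \<alpha> \<ge> 1}"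
proof (rule finite_subset)
  have "length \<alpha> \<le> sum_list \<alpha>" if "\<forall>k\<in>set \<alpha>. k \<ge> 1" for \<alpha> :: "nat list"
    using that by (induction \<alpha>) auto
  moreover have "set \<alpha> \<subseteq> {..sum_list \<alpha>}" for \<alpha> :: "nat list"
    by (auto intro: member_le_sum_list)
  ultimately show "{\<alpha>. is_partition \<alpha> n \<and> length \<alpha> \<ge> 1}
      \<subseteq> {\<alpha>. set \<alpha> \<subseteq> {..n} \<and> length \<alpha> \<le> n}"
    unfolding is_partition_def by blast
  show "finite {\<alpha>. set \<alpha> \<subseteq> {..n} \<and> length \<alpha> \<le> n}"
    by (rule finite_lists_length_le) simp
qed

end

theory Submission
  imports Defs "HOL-Combinatorics.Multiset_Permutations"
begin

text \<open>
  A conjugacy class of cycle type \<open>\<alpha>\<close> has \<open>n! r(\<alpha>) / (m! \<Prod>\<alpha>\<^sub>i)\<close> elements, where \<open>r(\<alpha>)\<close> is the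
  number of rearrangements of \<open>\<alpha>\<close>. So \<open>24 G\<^sub>1\<close> turns into a sum over compositions \<open>c\<close> of \<open>n\<close>,
  weighted by \<open>1/m!\<close> and the product of the coefficients of \<open>\<psi>\<^sub>0\<close> at the parts. As
  \<open>\<psi>\<^sub>1 = x \<psi>\<^sub>0'\<close>, a factor \<open>e\<^sub>i(c)\<close> replaces \<open>i\<close> of the \<open>m\<close> factors \<open>\<psi>\<^sub>0\<close> by \<open>\<psi>\<^sub>1\<close>, and the
  coefficient of \<open>x\<^sup>n\<close> in \<open>24 G\<^sub>1\<close> is the coefficient of \<open>x\<^sup>n\<close> in \<open>(h(\<psi>\<^sub>1) - 1/n) exp(n \<psi>\<^sub>0)\<close>,
  where \<open>h(t) = 1 - \<Sum>\<^bsub>i \<ge> 2\<^esub> t\<^sup>i / (i (i - 1)) = (1 - t) (1 - log (1 - t))\<close>.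
  Lagrange inversion, in the form that the coefficient of \<open>x\<^sup>n\<close> in \<open>F(s)\<close> is that of
  \<open>F (1 - \<psi>\<^sub>1) exp(n \<psi>\<^sub>0)\<close>, identifies the two parts with \<open>log (1 / (1 - \<psi>\<^sub>1(s)))\<close> and \<open>\<psi>\<^sub>0(s)\<close>.
\<close>

unbundle fps_syntax

subsection \<open>Permutations with given cycle lengths\<close>

text \<open>\<open>cycle_type\<close> is tied to the set {1..n}; an arbitrary carrier set allows an
  induction that inserts one element at a time.\<close>

definition cycle_mset :: "('a \<Rightarrow> 'a) \<Rightarrow> 'a set \<Rightarrow> nat multiset" where
  "cycle_mset p S = image_mset card (mset_set (orbit p ` S))"

lemma permutes_orbit:
  assumes "finite S" "p permutes S"
  shows self_in_orbit_permutes: "x \<in> orbit p x"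
    and orbit_eq_permutes: "y \<in> orbit p x \<Longrightarrow> orbit p y = orbit p x"
    and orbit_sub_permutes: "x \<in> S \<Longrightarrow> orbit p x \<subseteq> S"
proof -
  show self: "x \<in> orbit p x" for x
    using assms by (intro permutation_self_in_orbit) (auto simp: permutation_permutes)
  show "orbit p y = orbit p x" if "y \<in> orbit p x" for y
    using that self by (meson orbit_swap orbit_trans subsetI subset_antisym)
  show "orbit p x \<subseteq> S" if "x \<in> S"
  proof
    fix y assume "y \<in> orbit p x"
    then show "y \<in> S"
      by induction (use that assms(2) in \<open>auto simp: permutes_in_image\<close>)
  qed
qed

text \<open>The transposition splices \<open>a\<close> into the cycle of \<open>b\<close>, just
  before \<open>b\<close>: the point that \<open>p\<close> sends to \<open>b\<close> now goes to
  \<open>a\<close>, and \<open>a\<close> goes to \<open>b\<close>. All other points move as under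
  \<open>p\<close>.\<close>

lemma orbit_transpose_comp:
  assumes "finite S" "p permutes S" "a \<notin> S" "b \<in> S"
  shows orbit_transpose_comp_in:
      "x \<in> insert a (orbit p b) \<Longrightarrow> orbit (transpose a b \<circ> p) x = insert a (orbit p b)"
    and orbit_transpose_comp_notin:
      "x \<in> S \<Longrightarrow> x \<notin> orbit p b \<Longrightarrow> orbit (transpose a b \<circ> p) x = orbit p x"
proof -
  define q where "q = transpose a b \<circ> p"
  have ab: "a \<noteq> b" using assms by auto
  have pa: "p a = a" using assms(2,3) by (simp add: permutes_not_in)
  have qa: "q a = b" by (simp add: q_def pa)
  have qb: "q y = a" if "p y = b" for y using that by (simp add: q_def)
  have qo: "q y = p y" if "p y \<noteq> b" "y \<noteq> a" for y
  proof -
    have "p y \<noteq> a" using pa that(2) permutes_inj[OF assms(2)] by (metis injD)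
    then show ?thesis using that by (simp add: q_def)
  qed
  have q: "q permutes insert a S"
    unfolding q_def using assms
    by (intro permutes_compose permutes_imp_permutes_insert permutes_swap_id) auto
  have fin: "finite (insert a S)" using assms by simp
  have sub: "orbit p b \<subseteq> S" using orbit_sub_permutes[OF assms(1,2,4)] .
  have closed: "y \<in> insert a (orbit p b)" if "y \<in> orbit q a" for y
    using that
  proof induction
    case base
    then show ?case using qa self_in_orbit_permutes[OF assms(1,2)] by simp
  next
    case (step y)
    show ?case
    proof (cases "y = a")
      case True
      then show ?thesis using qa self_in_orbit_permutes[OF assms(1,2)] by simp
    next
      case False
      then show ?thesis using step qb[of y] qo[of y] by (cases "p y = b") (auto intro: orbit.step)
    qed
  qed
  have a_in: "a \<in> orbit q a" by (rule self_in_orbit_permutes[OF fin q])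
  have "b \<in> orbit q a" using orbit.base[of q a] qa by simp
  \<comment> \<open>A step of \<open>p\<close> inside this orbit is either a step of
    \<open>q\<close> or lands on \<open>b\<close>, which is already known to lie in
    \<open>orbit q a\<close>.\<close>
  have "y \<in> orbit q a" if "y \<in> orbit p b" for y
    using that
  proof induction
    case base
    have "q b \<in> orbit q a" using \<open>b \<in> orbit q a\<close> by (rule orbit.step)
    then show ?case using qo[of b] ab \<open>b \<in> orbit q a\<close> by (cases "p b = b") auto
  next
    case (step y)
    then have "q y \<in> orbit q a" "y \<noteq> a" using assms(3) sub by (auto intro: orbit.step)
    then show ?case using qo[of y] \<open>b \<in> orbit q a\<close> by (cases "p y = b") auto
  qed
  then have eq: "orbit q a = insert a (orbit p b)" using closed a_in by blast
  then show "orbit (transpose a b \<circ> p) x = insert a (orbit p b)" if "x \<in> insert a (orbit p b)"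
    using that orbit_eq_permutes[OF fin q, of x a] by (simp add: q_def)
  show "orbit (transpose a b \<circ> p) x = orbit p x" if x: "x \<in> S" "x \<notin> orbit p b"
    unfolding q_def[symmetric]
  proof (rule orbit_cong)
    show "x \<in> orbit p x" by (rule self_in_orbit_permutes[OF assms(1,2)])
    fix s assume s: "s \<in> orbit p x"
    have "s \<noteq> a" using s orbit_sub_permutes[OF assms(1,2) x(1)] assms(3) by auto
    moreover have "p s \<noteq> b"
    proof
      assume "p s = b"
      then have "b \<in> orbit p x" using orbit.step[OF s] by simp
      then show False using x(2) orbit_eq_permutes[OF assms(1,2)]
          self_in_orbit_permutes[OF assms(1,2), of x] by blast
    qed
    ultimately show "q s = p s" by (rule qo[rotated])
  qed
qed

lemma cycle_mset_insert_fixed: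
  assumes "finite S" "p permutes S" "a \<notin> S"
  shows "cycle_mset p (insert a S) = add_mset 1 (cycle_mset p S)"
proof -
  have "p a = a" using assms by (simp add: permutes_not_in)
  have "y = a" if "y \<in> orbit p a" for y
    using that by induction (auto simp: \<open>p a = a\<close>)
  then have oa: "orbit p a = {a}" using self_in_orbit_permutes[OF assms(1,2)] by blast
  have "{a} \<notin> orbit p ` S"
    using assms orbit_sub_permutes[OF assms(1,2)] by blast
  then show ?thesis using assms by (simp add: cycle_mset_def oa)
qed

lemma cycle_mset_insert_transpose:
  assumes "finite S" "p permutes S" "a \<notin> S" "b \<in> S"
  shows "cycle_mset (transpose a b \<circ> p) (insert a S) =
    add_mset (Suc (card (orbit p b))) (cycle_mset p S - {#card (orbit p b)#})"
proof -
  let ?q = "transpose a b \<circ> p"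
  let ?O = "orbit p ` S"
  have sub: "orbit p x \<subseteq> S" if "x \<in> S" for x using orbit_sub_permutes[OF assms(1,2) that] .
  have eqo: "x \<in> orbit p b" if "orbit p x = orbit p b" for x
    using that self_in_orbit_permutes[OF assms(1,2), of x] by simp
  have img: "orbit ?q ` insert a S = insert (insert a (orbit p b)) (?O - {orbit p b})" (is "?L = ?R")
  proof
    show "?L \<subseteq> ?R"
    proof
      fix y assume "y \<in> ?L"
      then obtain x where x: "x \<in> insert a S" "y = orbit ?q x" by blast
      show "y \<in> ?R"
      proof (cases "x \<in> insert a (orbit p b)")
        case True
        then show ?thesis using x orbit_transpose_comp_in[OF assms True] by simp
      next
        case False
        then have "x \<in> S" "x \<notin> orbit p b" using x by auto
        then show ?thesis using x orbit_transpose_comp_notin[OF assms, of x] eqo[of x] by auto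
      qed
    qed
    show "?R \<subseteq> ?L"
    proof
      fix y assume "y \<in> ?R"
      then consider "y = insert a (orbit p b)" | x where "x \<in> S" "y = orbit p x" "orbit p x \<noteq> orbit p b"
        by blast
      then show "y \<in> ?L"
      proof cases
        case 1
        then show ?thesis using orbit_transpose_comp_in[OF assms, of a] by auto
      next
        case 2
        then have "x \<notin> orbit p b" using orbit_eq_permutes[OF assms(1,2)] by blast
        then show ?thesis using orbit_transpose_comp_notin[OF assms 2(1)] 2 by auto
      qed
    qed
  qed
  \<comment> \<open>\<open>mset_set\<close> counts distinct orbits, so the enlarged orbit must
    differ from all old ones; only it contains \<open>a\<close>.\<close>
  have notin: "insert a (orbit p b) \<notin> ?O" using sub assms(3) by blast
  have inO: "orbit p b \<in> ?O" using assms(4) by blast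
  have "a \<notin> orbit p b" "finite (orbit p b)"
    using sub[OF assms(4)] assms(1,3) by (auto intro: finite_subset)
  then show ?thesis
    unfolding cycle_mset_def img using assms(1) notin inO
    by (simp add: mset_set_Diff image_mset_Diff)
qed

text \<open>These points form a disjoint union of orbits of size \<open>k\<close>. The lemma counts
  the places where a new element can be spliced into a cycle of length \<open>k\<close>.\<close>

lemma card_orbit_size:
  assumes "finite S" "p permutes S"
  shows "card {b \<in> S. card (orbit p b) = k} = k * count (cycle_mset p S) k"
proof -
  let ?C = "{u \<in> orbit p ` S. card u = k}"
  have "{b \<in> S. card (orbit p b) = k} = \<Union>?C"
  proof
    show "{b \<in> S. card (orbit p b) = k} \<subseteq> \<Union>?C"
      using self_in_orbit_permutes[OF assms] by blast
    show "\<Union>?C \<subseteq> {b \<in> S. card (orbit p b) = k}"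
    proof
      fix b assume "b \<in> \<Union>?C"
      then obtain x where x: "x \<in> S" "card (orbit p x) = k" "b \<in> orbit p x" by blast
      then show "b \<in> {b \<in> S. card (orbit p b) = k}"
        using orbit_sub_permutes[OF assms x(1)] orbit_eq_permutes[OF assms x(3)] by auto
    qed
  qed
  moreover have "k * card ?C = card (\<Union>?C)"
  proof (rule card_partition)
    show "finite ?C" using assms by simp
    show "finite (\<Union>?C)"
      using assms orbit_sub_permutes[OF assms] by (auto intro: finite_subset)
    show "\<And>c. c \<in> ?C \<Longrightarrow> card c = k" by simp
    show "c1 \<inter> c2 = {}" if c: "c1 \<in> ?C" "c2 \<in> ?C" "c1 \<noteq> c2" for c1 c2
    proof (rule ccontr)
      assume "c1 \<inter> c2 \<noteq> {}"
      then obtain z where z: "z \<in> c1" "z \<in> c2" by blast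
      obtain x where "c1 = orbit p x" using c(1) by auto
      moreover obtain y where "c2 = orbit p y" using c(2) by auto
      ultimately show False
        using z orbit_eq_permutes[OF assms, of z x] orbit_eq_permutes[OF assms, of z y] c(3) by simp
    qed
  qed
  moreover have "count (cycle_mset p S) k = card ?C"
    unfolding cycle_mset_def using assms
    by (simp add: count_image_mset' sum.If_cases count_mset_set' Int_def conj_commute eq_commute[of k] cong: conj_cong)
  ultimately show ?thesis by simp
qed

lemma sum_mset_sum_count: "sum_mset M = (\<Sum>k\<in>set_mset M. k * count M k)" for M :: "nat multiset"
proof (induction M)
  case (add x M)
  have "(\<Sum>k\<in>set_mset (add_mset x M). k * count (add_mset x M) k) =
      (\<Sum>k\<in>insert x (set_mset M). k * count M k + (if k = x then x else 0))"
    by (intro sum.cong) (auto simp: algebra_simps)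
  also have "\<dots> = x + (\<Sum>k\<in>insert x (set_mset M). k * count M k)"
    by (simp add: sum.distrib)
  also have "(\<Sum>k\<in>insert x (set_mset M). k * count M k) = (\<Sum>k\<in>set_mset M. k * count M k)"
    by (intro sum.mono_neutral_right) (auto simp: not_in_iff)
  finally show ?case using add by simp
qed simp

text \<open>For positive parts, this is the order of the centralizer of a permutation with cycle
  lengths \<open>M\<close>.\<close>

definition cycle_weight :: "nat multiset \<Rightarrow> nat" where
  "cycle_weight M = \<Prod>\<^sub># M * (\<Prod>k\<in>set_mset M. fact (count M k))"

lemma cycle_weight_add_mset:
  "cycle_weight (add_mset k M) = cycle_weight M * (k * Suc (count M k))"
proof -
  let ?f = "\<lambda>j. fact (count (add_mset k M) j) :: nat"
  have "(\<Prod>j\<in>set_mset (add_mset k M). ?f j) = ?f k * (\<Prod>j\<in>set_mset M - {k}. ?f j)"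
    by (simp add: prod.insert_remove)
  also have "(\<Prod>j\<in>set_mset M - {k}. ?f j) = (\<Prod>j\<in>set_mset M - {k}. fact (count M j))"
    by (intro prod.cong) auto
  also have "?f k = Suc (count M k) * fact (count M k)" by simp
  also have "Suc (count M k) * fact (count M k) * (\<Prod>j\<in>set_mset M - {k}. fact (count M j)) =
      Suc (count M k) * (\<Prod>j\<in>set_mset M. fact (count M j))"
    by (cases "k \<in># M") (simp_all add: prod.remove[of _ k] not_in_iff algebra_simps)
  finally show ?thesis by (simp add: cycle_weight_def algebra_simps)
qed

text \<open>
  Every permutation of \<open>insert a S\<close> arises from a permutation of \<open>S\<close> by inserting \<open>a\<close>
  as a fixed point or into an existing cycle. With \<open>n = card S\<close>, the permutations with cycle
  lengths \<open>M\<close> in which \<open>a\<close> lies on a cycle of length \<open>j\<close> contribute \<open>j * count M j * n!\<close>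
  to the left-hand side, and these contributions add up to \<open>(n + 1)!\<close>.
\<close>

lemma card_cycle_mset:
  assumes "finite S" "sum_mset M = card S" "0 \<notin># M"
  shows "card {p. p permutes S \<and> cycle_mset p S = M} * cycle_weight M = fact (card S)"
  using assms
proof (induction S arbitrary: M rule: finite_induct)
  case empty
  then have "M = {#}" by (cases M) auto
  moreover have "{p. p permutes {} \<and> cycle_mset p {} = {#}} = {id :: 'a \<Rightarrow> 'a}"
    by (auto simp: cycle_mset_def)
  ultimately show ?case by (simp add: cycle_weight_def)
next
  case (insert a S)
  let ?P = "{p. p permutes S}"
  let ?c = "\<lambda>M. card {p. p permutes S \<and> cycle_mset p S = M}"
  \<comment> \<open>The number of permutations with \<open>a\<close> on a cycle of length
    \<open>j\<close>. Deleting \<open>a\<close> turns one part \<open>j\<close> into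
    \<open>j - 1\<close>, and the last factor counts the points on cycles of length
    \<open>j - 1\<close>, each of which is a possible successor of \<open>a\<close>.\<close>
  let ?A = "\<lambda>j. if j = 1 then ?c (M - {#1#})
     else ?c (add_mset (j - 1) (M - {#j#})) * ((j - 1) * Suc (count (M - {#j#}) (j - 1)))"
  have finP: "finite ?P" using insert(1) by (rule finite_permutations)
  have card_sum: "card {p. p permutes S \<and> Q p} = (\<Sum>p\<in>?P. of_bool (Q p))" for Q
    using finP by (simp add: Int_def)
  have fixed: "(\<Sum>p\<in>?P. of_bool (cycle_mset p (insert a S) = M)) = (if 1 \<in># M then ?c (M - {#1#}) else 0)"
  proof (cases "1 \<in># M")
    case True
    then obtain N where M: "M = add_mset 1 N" by (auto dest: multi_member_split)
    have "cycle_mset p (insert a S) = M \<longleftrightarrow> cycle_mset p S = M - {#1#}" if "p \<in> ?P" for p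
      using cycle_mset_insert_fixed[OF insert(1) _ insert(2), of p] that M by simp
    then show ?thesis
      unfolding card_sum if_P[OF True] by (intro sum.cong refl) simp
  next
    case False
    have "cycle_mset p (insert a S) \<noteq> M" if "p \<in> ?P" for p
    proof -
      have "1 \<in># cycle_mset p (insert a S)"
        using cycle_mset_insert_fixed[OF insert(1) _ insert(2), of p] that by simp
      then show ?thesis using False by blast
    qed
    then show ?thesis unfolding if_not_P[OF False] by (intro sum.neutral) simp
  qed
  have moved: "(\<Sum>b\<in>S. of_bool (cycle_mset (transpose a b \<circ> p) (insert a S) = M)) =
      (\<Sum>j\<in>set_mset M - {1}. of_bool (cycle_mset p S = add_mset (j - 1) (M - {#j#})) *
        ((j - 1) * Suc (count (M - {#j#}) (j - 1))))"
    if p: "p \<in> ?P" for p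
  proof -
    have p': "p permutes S" using p by simp
    have pos: "card (orbit p b) > 0" if "b \<in> S" for b
      using that insert(1) self_in_orbit_permutes[OF insert(1) p', of b]
        orbit_sub_permutes[OF insert(1) p' that] by (auto simp: card_gt_0_iff intro: finite_subset)
    have mem: "card (orbit p b) \<in># cycle_mset p S" if "b \<in> S" for b
      using that insert(1) by (auto simp: cycle_mset_def)
    have key: "cycle_mset (transpose a b \<circ> p) (insert a S) = M \<and> Suc (card (orbit p b)) = j \<longleftrightarrow>
        cycle_mset p S = add_mset (j - 1) (M - {#j#}) \<and> card (orbit p b) = j - 1"
      if "b \<in> S" "j \<in> set_mset M - {1}" for b j
    proof -
      have "j > 0" using that insert.prems by (cases j) auto
      then have "j = Suc (j - 1)" by simp
      moreover have "j \<in># M" using that by simp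
      ultimately show ?thesis
        unfolding cycle_mset_insert_transpose[OF insert(1) p' insert(2) that(1)]
        using mem[OF that(1)]
        by (metis add_mset_remove_trivial diff_Suc_1 insert_DiffM)
    qed
    \<comment> \<open>For given \<open>b\<close> only \<open>j = Suc (card (orbit p b))\<close>, the
      length of the enlarged cycle, can contribute. It is never 1, since orbits are
      nonempty.\<close>
    have "of_bool (cycle_mset (transpose a b \<circ> p) (insert a S) = M) =
       (\<Sum>j\<in>set_mset M - {1}. of_bool (cycle_mset p S = add_mset (j - 1) (M - {#j#})) *
          of_bool (card (orbit p b) = j - 1) :: nat)" if b: "b \<in> S" for b
    proof -
      let ?q = "transpose a b \<circ> p"
      have "(\<Sum>j\<in>set_mset M - {1}. of_bool (cycle_mset p S = add_mset (j - 1) (M - {#j#})) *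
          of_bool (card (orbit p b) = j - 1) :: nat)
        = (\<Sum>j\<in>set_mset M - {1}. of_bool (Suc (card (orbit p b)) = j) * of_bool (cycle_mset ?q (insert a S) = M))"
        using key[OF b] by (intro sum.cong refl) (simp only: of_bool_conj[symmetric] conj_commute)
      also have "\<dots> = of_bool (cycle_mset ?q (insert a S) = M)"
      proof (cases "cycle_mset ?q (insert a S) = M")
        case True
        then have "Suc (card (orbit p b)) \<in># M"
          unfolding cycle_mset_insert_transpose[OF insert(1) p' insert(2) b] by auto
        then have "Suc (card (orbit p b)) \<in> set_mset M - {1}" using pos[OF b] by simp
        then show ?thesis using True by (simp add: of_bool_def)
      qed simp
      finally show ?thesis by simp
    qed
    then have "(\<Sum>b\<in>S. of_bool (cycle_mset (transpose a b \<circ> p) (insert a S) = M)) =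
       (\<Sum>b\<in>S. \<Sum>j\<in>set_mset M - {1}. of_bool (cycle_mset p S = add_mset (j - 1) (M - {#j#})) *
          of_bool (card (orbit p b) = j - 1) :: nat)"
      by (intro sum.cong refl)
    also have "\<dots> = (\<Sum>j\<in>set_mset M - {1}. of_bool (cycle_mset p S = add_mset (j - 1) (M - {#j#})) *
          (\<Sum>b\<in>S. of_bool (card (orbit p b) = j - 1)))"
      unfolding sum_distrib_left by (rule sum.swap)
    also have "\<dots> = (\<Sum>j\<in>set_mset M - {1}. of_bool (cycle_mset p S = add_mset (j - 1) (M - {#j#})) *
          ((j - 1) * count (cycle_mset p S) (j - 1)))"
    proof -
      have "(\<Sum>b\<in>S. of_bool (card (orbit p b) = k)) = k * count (cycle_mset p S) k" for k
        using insert(1) card_orbit_size[OF insert(1) p'] by (simp add: Int_def)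
      then show ?thesis by simp
    qed
    \<comment> \<open>Where the indicator is nonzero, the number of cycles of length
      \<open>j - 1\<close> is determined by \<open>M\<close>, so \<open>p\<close> survives only in
      the indicator.\<close>
    also have "\<dots> = (\<Sum>j\<in>set_mset M - {1}. of_bool (cycle_mset p S = add_mset (j - 1) (M - {#j#})) *
          ((j - 1) * Suc (count (M - {#j#}) (j - 1))))"
    proof (intro sum.cong refl)
      fix j assume "j \<in> set_mset M - {1}"
      then have "j \<noteq> 0" "j \<noteq> 1" using insert.prems(2) by (auto intro: ccontr)
      then have "j - 1 \<noteq> j" by simp
      then show "of_bool (cycle_mset p S = add_mset (j - 1) (M - {#j#})) * ((j - 1) * count (cycle_mset p S) (j - 1)) =
        of_bool (cycle_mset p S = add_mset (j - 1) (M - {#j#})) * ((j - 1) * Suc (count (M - {#j#}) (j - 1)))"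
        by (cases "cycle_mset p S = add_mset (j - 1) (M - {#j#})") simp_all
    qed
    finally show ?thesis .
  qed
  have "card {p. p permutes insert a S \<and> cycle_mset p (insert a S) = M} =
      (\<Sum>p | p permutes insert a S. of_bool (cycle_mset p (insert a S) = M))"
    using insert(1) finite_permutations[of "insert a S"] by (simp add: Int_def)
  \<comment> \<open>A permutation of \<open>insert a S\<close> is
    \<open>transpose a b \<circ> p\<close> for unique \<open>b\<close> and \<open>p\<close>; the
    choice \<open>b = a\<close> gives the first sum.\<close>
  also have "\<dots> = (\<Sum>p\<in>?P. of_bool (cycle_mset p (insert a S) = M)) +
      (\<Sum>p\<in>?P. \<Sum>b\<in>S. of_bool (cycle_mset (transpose a b \<circ> p) (insert a S) = M))"
    unfolding sum_over_permutations_insert[OF insert(1,2)] sum.insert[OF insert(1,2)]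
      sum.swap[of _ S ?P] by simp
  also have "\<dots> = (if 1 \<in># M then ?c (M - {#1#}) else 0) + (\<Sum>j\<in>set_mset M - {1}. ?A j)"
  proof -
    have "(\<Sum>p\<in>?P. \<Sum>b\<in>S. of_bool (cycle_mset (transpose a b \<circ> p) (insert a S) = M)) =
      (\<Sum>j\<in>set_mset M - {1}. \<Sum>p\<in>?P. of_bool (cycle_mset p S = add_mset (j - 1) (M - {#j#})) *
        ((j - 1) * Suc (count (M - {#j#}) (j - 1))))"
      by (subst sum.swap) (intro sum.cong refl moved)
    also have "\<dots> = (\<Sum>j\<in>set_mset M - {1}. ?A j)"
      by (intro sum.cong refl) (simp only: card_sum sum_distrib_right[symmetric], simp)
    finally show ?thesis unfolding fixed by simp
  qed
  also have "\<dots> = (\<Sum>j\<in>set_mset M. ?A j)"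
    by (cases "1 \<in># M") (simp_all add: sum.remove[of "set_mset M" 1])
  finally have rec: "card {p. p permutes insert a S \<and> cycle_mset p (insert a S) = M} =
    (\<Sum>j\<in>set_mset M. ?A j)" .
  have "?A j * cycle_weight M = j * count M j * fact (card S)" if j: "j \<in># M" for j
  proof -
    obtain N where M: "M = add_mset j N" using j by (auto dest: multi_member_split)
    have N0: "0 \<notin># N" "j > 0" using insert.prems M by auto
    have card: "j + sum_mset N = Suc (card S)" using insert.prems(1) insert(1,2) M by simp
    show ?thesis
    proof (cases "j = 1")
      case True
      then show ?thesis using insert.IH[of N] N0 card M by (simp add: cycle_weight_add_mset algebra_simps)
    next
      case False
      then have "?c (add_mset (j - 1) N) * cycle_weight (add_mset (j - 1) N) = fact (card S)"
        using N0 card by (intro insert.IH) auto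
      \<comment> \<open>Both multisets add one part to \<open>N\<close>, so the splicing factor in
        \<open>?A j\<close> is exactly what completes the weight of the smaller one.\<close>
      moreover have "?A j * cycle_weight M =
          ?c (add_mset (j - 1) N) * cycle_weight (add_mset (j - 1) N) * (j * count M j)"
        using False M by (simp only: if_False cycle_weight_add_mset add_mset_remove_trivial
            count_add_mset refl if_True mult_ac)
      ultimately show ?thesis by (simp only: mult_ac)
    qed
  qed
  then have "(\<Sum>j\<in>set_mset M. ?A j) * cycle_weight M = (\<Sum>j\<in>set_mset M. j * count M j) * fact (card S)"
    unfolding sum_distrib_right by (intro sum.cong refl) auto
  also have "(\<Sum>j\<in>set_mset M. j * count M j) = sum_mset M"
    by (simp add: sum_mset_sum_count)
  finally show ?case unfolding rec using insert by simp
qed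

subsection \<open>Lagrange inversion over an integral domain\<close>


text \<open>Since \<open>g ^ k\<close> has no terms below degree \<open>k\<close>, one bound
  \<open>n\<close> serves for every coefficient of the composition that occurs, and the sums can be
  exchanged.\<close>

lemma fps_compose_mult_nth:
  fixes a g b :: "'a::comm_ring_1 fps"
  assumes "g $ 0 = 0"
  shows "((a oo g) * b) $ n = (\<Sum>k\<le>n. a $ k * (g ^ k * b) $ n)"
proof -
  have "(a oo g) $ i = (\<Sum>k\<le>n. a $ k * (g ^ k) $ i)" if "i \<le> n" for i
    unfolding fps_compose_nth using that startsby_zero_power_prefix[OF assms]
    by (intro sum.mono_neutral_left) auto
  then have "((a oo g) * b) $ n = (\<Sum>i=0..n. \<Sum>k\<le>n. a $ k * ((g ^ k) $ i * b $ (n - i)))"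
    by (simp add: fps_mult_nth sum_distrib_right mult.assoc)
  also have "\<dots> = (\<Sum>k\<le>n. a $ k * (g ^ k * b) $ n)"
    by (subst sum.swap) (simp add: fps_mult_nth sum_distrib_left)
  finally show ?thesis .
qed

lemma fps_left_compinv_exists:
  fixes g :: "'a::comm_ring_1 fps"
  assumes "g $ 0 = 0" "g $ 1 = 1"
  obtains h where "h $ 0 = 0" "h $ 1 = 1" "h oo g = fps_X"
proof -
  define step where "step r n = (if n = 1 then 1 else 0) - (\<Sum>k<n. r k * (g ^ k) $ n)"
    for r :: "nat \<Rightarrow> 'a" and n
  \<comment> \<open>Well-founded recursion applies because \<open>step\<close> at \<open>n\<close>
    consults only values below \<open>n\<close>.\<close>
  define c where "c = wfrec less_than step"
  have "adm_wf less_than step"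
    by (auto simp: adm_wf_def step_def)
  then have c: "c n = (if n = 1 then 1 else 0) - (\<Sum>k<n. c k * (g ^ k) $ n)" for n
    unfolding c_def by (subst wfrec_fixpoint) (auto simp: step_def c_def)
  define h where "h = Abs_fps c"
  have "(h oo g) $ n = fps_X $ n" for n
  proof -
    have "(h oo g) $ n = (\<Sum>k<n. c k * (g ^ k) $ n) + c n * (g ^ n) $ n"
      by (simp add: fps_compose_nth h_def atLeast0AtMost lessThan_Suc_atMost[symmetric])
    also have "(g ^ n) $ n = 1" using assms by (simp add: startsby_zero_power_nth_same)
    finally show ?thesis using c[of n] by simp
  qed
  then have hg: "h oo g = fps_X" by (simp add: fps_eq_iff)
  have "h $ 0 = 0" using c[of 0] by (simp add: h_def)
  moreover have "h $ 1 = 1" using c[of 1] by (simp add: h_def)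
  ultimately show thesis using hg that by blast
qed

text \<open>The left inverse \<open>h\<close> has a left inverse \<open>k\<close> of its own, and
  associativity forces \<open>k = g\<close>.\<close>

lemma fps_compinv_exists:
  fixes g :: "'a::idom fps"
  assumes "g $ 0 = 0" "g $ 1 = 1"
  obtains h where "h $ 0 = 0" "h oo g = fps_X" "g oo h = fps_X"
proof -
  obtain h where h: "h $ 0 = 0" "h $ 1 = 1" "h oo g = fps_X"
    using fps_left_compinv_exists[OF assms] .
  obtain k where k: "k $ 0 = 0" "k oo h = fps_X"
    using fps_left_compinv_exists[OF h(1,2)] .
  have "k = k oo (h oo g)" by (simp add: h(3))
  also have "\<dots> = g" using assms(1) h(1) k(2) by (simp add: fps_compose_assoc)
  finally show thesis using h k that by blast
qed

text \<open>Multiplication by \<open>\<phi>' oo s\<close> clears the right-hand side. The reciprocal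
  is supplied as \<open>\<phi>'\<close> because the coefficients need not form a field.\<close>

lemma functional_equation_iff_compinv:
  fixes \<phi> \<phi>' s :: "'a::idom fps"
  assumes "\<phi> * \<phi>' = 1"
  shows "s = fps_X * (\<phi> oo s) \<longleftrightarrow> s $ 0 = 0 \<and> (fps_X * \<phi>') oo s = fps_X"
proof -
  have zero: "s $ 0 = 0" if "s = fps_X * (\<phi> oo s)"
    by (subst that) simp
  have "s = fps_X * (\<phi> oo s) \<longleftrightarrow> (fps_X * \<phi>') oo s = fps_X" if s0: "s $ 0 = 0"
  proof -
    have inv: "(\<phi> oo s) * (\<phi>' oo s) = 1"
      using assms s0 by (simp flip: fps_compose_mult_distrib)
    have "(fps_X * \<phi>') oo s = s * (\<phi>' oo s)"
      using s0 by (simp add: fps_compose_mult_distrib)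
    moreover have "s = fps_X * (\<phi> oo s) \<longleftrightarrow> s * (\<phi>' oo s) = fps_X"
    proof
      assume "s = fps_X * (\<phi> oo s)"
      then have "s * (\<phi>' oo s) = fps_X * (\<phi> oo s) * (\<phi>' oo s)" by simp
      then show "s * (\<phi>' oo s) = fps_X" by (simp add: mult.assoc inv)
    next
      assume "s * (\<phi>' oo s) = fps_X"
      then have "fps_X * (\<phi> oo s) = s * ((\<phi> oo s) * (\<phi>' oo s))" by (simp add: mult_ac)
      then show "s = fps_X * (\<phi> oo s)" by (simp add: inv)
    qed
    ultimately show ?thesis by simp
  qed
  with zero show ?thesis by blast
qed

text \<open>Solutions are the right compositional inverses of \<open>fps_X * \<phi>'\<close>; this
  series has a two-sided inverse, with which each of them coincides.\<close>

lemma functional_equation_ex1: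
  fixes \<phi> \<phi>' :: "'a::idom fps"
  assumes "\<phi> * \<phi>' = 1" "\<phi> $ 0 = 1"
  shows "\<exists>!s. s = fps_X * (\<phi> oo s)"
proof -
  let ?g = "fps_X * \<phi>'"
  have "(\<phi> * \<phi>') $ 0 = 1" using assms(1) by simp
  then have "\<phi>' $ 0 = 1" using assms(2) by simp
  then obtain h where h: "h $ 0 = 0" "h oo ?g = fps_X" "?g oo h = fps_X"
    by (auto intro: fps_compinv_exists[of ?g])
  have "s = h" if "s $ 0 = 0" "?g oo s = fps_X" for s
  proof -
    have "s = (h oo ?g) oo s" using h(2) that(1) by simp
    also have "\<dots> = h oo (?g oo s)" using that(1) by (intro fps_compose_assoc[symmetric]) simp_all
    finally show ?thesis using that(2) by simp
  qed
  then show ?thesis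
    unfolding functional_equation_iff_compinv[OF assms(1)] using h by blast
qed

text \<open>
  This replaces the usual residue argument: multiplied by \<open>n > 0\<close>, the series on the left becomes
  \<open>n \<phi>\<^sup>n - x (\<phi>\<^sup>n)'\<close>, whose coefficient at \<open>n\<close> vanishes.
\<close>

lemma lagrange_core:
  fixes \<phi> \<phi>' :: "'a::{idom, ring_char_0} fps"
  assumes "\<phi> * \<phi>' = 1" "\<phi> $ 0 = 1"
  shows "(\<phi> ^ n * (1 - fps_X * fps_deriv \<phi> * \<phi>')) $ n = (if n = 0 then 1 else 0)"
proof (cases n)
  case (Suc m)
  have "\<phi> ^ n * (1 - fps_X * fps_deriv \<phi> * \<phi>') =
      \<phi> ^ n - fps_X * (fps_deriv \<phi> * \<phi> ^ m * (\<phi> * \<phi>'))"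
    by (simp add: Suc algebra_simps)
  then have eq: "\<phi> ^ n * (1 - fps_X * fps_deriv \<phi> * \<phi>') = \<phi> ^ n - fps_X * (fps_deriv \<phi> * \<phi> ^ m)"
    by (simp only: assms(1) mult_1_right)
  have "of_nat n * (\<phi> ^ n * (1 - fps_X * fps_deriv \<phi> * \<phi>')) $ n =
      of_nat n * (\<phi> ^ n) $ n - of_nat n * (fps_deriv \<phi> * \<phi> ^ m) $ m"
    unfolding eq by (simp add: Suc right_diff_distrib)
  also have "of_nat n * (fps_deriv \<phi> * \<phi> ^ m) $ m = fps_deriv (\<phi> ^ n) $ m"
    by (simp add: fps_deriv_power Suc mult.assoc del: power_Suc of_nat_Suc)
  also have "\<dots> = of_nat n * (\<phi> ^ n) $ n" by (simp add: Suc del: power_Suc of_nat_Suc)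
  finally show ?thesis using Suc by (simp del: of_nat_Suc)
qed simp

text \<open>As \<open>?g\<close> is the compositional inverse of \<open>s\<close>, \<open>F\<close>
  is \<open>F oo s\<close> expanded in powers of \<open>?g\<close>. By \<open>lagrange_core\<close>
  only the power with exponent \<open>n\<close> contributes to the coefficient at
  \<open>n\<close>.\<close>

theorem lagrange_inversion:
  fixes \<phi> \<phi>' s F :: "'a::{idom, ring_char_0} fps"
  assumes inv: "\<phi> * \<phi>' = 1" "\<phi> $ 0 = 1" and s: "s = fps_X * (\<phi> oo s)"
  shows "(F oo s) $ n = (F * (1 - fps_X * fps_deriv \<phi> * \<phi>') * \<phi> ^ n) $ n"
proof -
  let ?g = "fps_X * \<phi>'" and ?D = "1 - fps_X * fps_deriv \<phi> * \<phi>'"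
  have s0: "s $ 0 = 0" and gs: "?g oo s = fps_X"
    using s functional_equation_iff_compinv[OF inv(1)] by auto
  have "(\<phi> * \<phi>') $ 0 = 1" using inv(1) by simp
  then have "\<phi>' $ 0 = 1" using inv(2) by simp
  then obtain h where h: "h $ 0 = 0" "h oo ?g = fps_X" "?g oo h = fps_X"
    by (auto intro: fps_compinv_exists[of ?g])
  have "h = h oo (?g oo s)" using gs by simp
  also have "\<dots> = s" using s0 h(2) by (simp add: fps_compose_assoc)
  finally have "(F oo s) oo ?g = F"
    using h(1,2) by (simp flip: fps_compose_assoc)
  then have "(F * ?D * \<phi> ^ n) $ n = (((F oo s) oo ?g) * (?D * \<phi> ^ n)) $ n"
    by (simp add: mult.assoc)
  also have "\<dots> = (\<Sum>k\<le>n. (F oo s) $ k * (?g ^ k * (?D * \<phi> ^ n)) $ n)"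
    by (rule fps_compose_mult_nth) simp
  also have "\<dots> = (\<Sum>k\<le>n. (F oo s) $ k * (if n - k = 0 then 1 else 0))"
  proof (intro sum.cong refl arg_cong2[where f = "(*)"])
    fix k assume "k \<in> {..n}"
    then have k: "k \<le> n" by simp
    \<comment> \<open>The factors of \<open>?g ^ k\<close> cancel \<open>k\<close> of the
      \<open>n\<close> factors \<open>\<phi>\<close>, which leaves \<open>lagrange_core\<close> at
      \<open>n - k\<close>.\<close>
    then have "\<phi> ^ n = \<phi> ^ k * \<phi> ^ (n - k)" by (simp flip: power_add)
    then have "?g ^ k * (?D * \<phi> ^ n) = fps_X ^ k * ((\<phi> * \<phi>') ^ k * (\<phi> ^ (n - k) * ?D))"
      by (simp only: power_mult_distrib mult_ac)
    also have "\<dots> = fps_X ^ k * (\<phi> ^ (n - k) * ?D)"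
      by (simp only: inv(1) power_one mult_1_left)
    finally show "(?g ^ k * (?D * \<phi> ^ n)) $ n = (if n - k = 0 then 1 else 0)"
      using k lagrange_core[OF inv, of "n - k"] by (simp only: fps_X_power_mult_nth leD if_False)
  qed
  also have "\<dots> = (\<Sum>k\<le>n. if k = n then (F oo s) $ k else 0)"
    by (intro sum.cong) auto
  finally show ?thesis by simp
qed

subsection \<open>The series \<open>\<psi>\<^sub>0\<close> and \<open>\<psi>\<^sub>1\<close>\<close>

lemma qconst_0 [simp]: "qconst 0 = 0"
  and qconst_1 [simp]: "qconst 1 = 1"
  and qconst_add: "qconst (a + b) = qconst a + qconst b"
  and qconst_uminus: "qconst (- a) = - qconst a"
  and qconst_diff: "qconst (a - b) = qconst a - qconst b"
  and qconst_mult: "qconst (a * b) = qconst a * qconst b"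
  by (simp_all add: qconst_def single_add single_uminus single_diff mult_single)

lemma qconst_sum: "qconst (\<Sum>i\<in>A. f i) = (\<Sum>i\<in>A. qconst (f i))"
  by (induction A rule: infinite_finite_induct) (simp_all add: qconst_add)

lemma qconst_prod: "qconst (\<Prod>i\<in>A. f i) = (\<Prod>i\<in>A. qconst (f i))"
  by (induction A rule: infinite_finite_induct) (simp_all add: qconst_mult)

lemma qconst_of_nat: "qconst (of_nat n) = of_nat n"
  by (induction n) (simp_all add: qconst_add)

text \<open>The series exp(cx). The parameter covers the reciprocal of \<open>\<Phi>\<close>
  (\<open>c = -1\<close>) and its powers (\<open>c = n\<close>).\<close>

definition exp_fps :: "rat \<Rightarrow> qp fps" where
  "exp_fps c = Abs_fps (\<lambda>k. qconst (c ^ k / fact k))"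

lemma exp_series_eq: "exp_series = exp_fps 1"
  by (simp add: exp_series_def exp_fps_def)

lemma exp_fps_0: "exp_fps 0 = 1"
  by (simp add: exp_fps_def fps_eq_iff power_0_left)

text \<open>Coefficientwise image under \<open>qconst\<close> of the addition law for
  \<open>fps_exp\<close> over the rationals.\<close>

lemma exp_fps_mult: "exp_fps c * exp_fps d = exp_fps (c + d)"
proof (rule fps_ext)
  fix n
  have "(exp_fps c * exp_fps d) $ n = qconst ((fps_exp c * fps_exp d) $ n)"
    by (simp add: fps_mult_nth exp_fps_def qconst_sum flip: qconst_mult)
  then show "(exp_fps c * exp_fps d) $ n = exp_fps (c + d) $ n"
    by (simp add: exp_fps_def flip: fps_exp_add_mult)
qed

lemma exp_fps_power: "exp_fps c ^ n = exp_fps (of_nat n * c)"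
  by (induction n) (simp_all add: exp_fps_0 exp_fps_mult algebra_simps)

lemma fps_deriv_exp_series: "fps_deriv exp_series = exp_series"
proof (rule fps_ext)
  fix n
  have "fps_deriv exp_series $ n = qconst (of_nat (Suc n)) * qconst (1 / fact (Suc n))"
    by (simp add: exp_series_def qconst_of_nat del: of_nat_Suc)
  also have "\<dots> = exp_series $ n"
    by (simp add: exp_series_def del: of_nat_Suc flip: qconst_mult)
  finally show "fps_deriv exp_series $ n = exp_series $ n" .
qed

lemma psi_nth_0 [simp]: "psi i $ 0 = 0"
  by (simp add: psi_def)

lemma psi_0_nth: "r > 0 \<Longrightarrow> psi 0 $ r = qconst (a_coeff r / of_nat r) * pvar r"
  by (simp add: psi_def power_int_minus field_simps)

lemma psi_1_nth: "psi (Suc 0) $ r = of_nat r * psi 0 $ r"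
  by (simp add: psi_def power_int_minus mult.assoc flip: qconst_of_nat qconst_mult)
    (simp flip: mult.assoc qconst_mult)

lemma psi_1_eq_deriv: "fps_X * fps_deriv (psi 0) = psi 1"
proof (rule fps_ext)
  fix n show "(fps_X * fps_deriv (psi 0)) $ n = psi 1 $ n"
    by (cases n) (simp_all add: psi_1_nth)
qed

text \<open>With this series the functional equation takes the Lagrange form
  \<open>s = fps_X * (\<Phi> oo s)\<close>.\<close>

definition \<Phi> :: "qp fps" where
  "\<Phi> = exp_series oo psi 0"

definition \<Phi>_inv :: "qp fps" where
  "\<Phi>_inv = exp_fps (-1) oo psi 0"

lemma \<Phi>_inverse: "\<Phi> * \<Phi>_inv = 1"
  unfolding \<Phi>_def \<Phi>_inv_def exp_series_eq
  by (simp add: exp_fps_mult exp_fps_0 flip: fps_compose_mult_distrib)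

lemma \<Phi>_nth_0: "\<Phi> $ 0 = 1"
  by (simp add: \<Phi>_def exp_series_def)

lemma \<Phi>_power: "\<Phi> ^ n = exp_fps (of_nat n) oo psi 0"
  unfolding \<Phi>_def exp_series_eq by (simp add: fps_compose_power exp_fps_power)

text \<open>The chain rule; it turns the factor
  \<open>1 - fps_X * fps_deriv \<Phi> * \<Phi>_inv\<close> of Lagrange inversion into
  \<open>1 - psi 1\<close>.\<close>

lemma X_deriv_\<Phi>: "fps_X * fps_deriv \<Phi> = psi 1 * \<Phi>"
  unfolding \<Phi>_def
  by (simp add: fps_compose_deriv fps_deriv_exp_series mult_ac flip: psi_1_eq_deriv del: One_nat_def)

lemma X_deriv_\<Phi>_inv: "fps_X * fps_deriv \<Phi> * \<Phi>_inv = psi 1"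
  by (simp add: X_deriv_\<Phi> mult.assoc \<Phi>_inverse)

lemma solves_functional_eq_iff:
  "solves_functional_eq s \<longleftrightarrow> s = fps_X * (\<Phi> oo s)"
proof -
  have "exp_series oo (psi 0 oo s) = \<Phi> oo s" if "s $ 0 = 0"
    unfolding \<Phi>_def using that by (simp add: fps_compose_assoc)
  \<comment> \<open>Either form of the equation makes \<open>s\<close> a multiple of x, as
    associativity of composition requires.\<close>
  moreover have "s $ 0 = 0" if "s = fps_X * f" for f
    by (subst that) simp
  ultimately show ?thesis
    unfolding solves_functional_eq_def by metis
qed

lemma lagrange_psi:
  assumes "solves_functional_eq s"
  shows "(F oo s) $ n = (F * (1 - psi 1) * \<Phi> ^ n) $ n"
  using lagrange_inversion[OF \<Phi>_inverse \<Phi>_nth_0, of s F n] assms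
  by (simp add: solves_functional_eq_iff X_deriv_\<Phi>_inv)

text \<open>Computing the coefficient at \<open>n\<close> of x times the derivative of
  \<open>psi 0 * \<Phi> ^ n\<close> in two ways reduces the Lagrange formula for
  \<open>psi 0\<close> to \<open>psi 1 * \<Phi> ^ n\<close>; by \<open>lagrange_core\<close>,
  \<open>psi 1\<close> may then be replaced by 1.\<close>

lemma psi_0_compose_nth:
  assumes "solves_functional_eq s" "n > 0"
  shows "(psi 0 oo s) $ n = qconst (1 / of_nat n) * (\<Phi> ^ n) $ n"
proof -
  have X_deriv_nth: "(fps_X * fps_deriv f) $ n = of_nat n * f $ n" for f :: "qp fps"
    using assms(2) by (cases n) simp_all
  have "fps_X * fps_deriv (\<Phi> ^ n) = of_nat n * (psi 1 * \<Phi> ^ n)"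
  proof -
    obtain m where n: "n = Suc m" using assms(2) by (cases n) auto
    have "fps_X * fps_deriv (\<Phi> ^ n) = of_nat n * ((fps_X * fps_deriv \<Phi>) * \<Phi> ^ m)"
      by (simp only: fps_deriv_power' n diff_Suc_1 mult_ac)
    then show ?thesis by (simp only: X_deriv_\<Phi> n power_Suc mult_ac)
  qed
  then have "fps_X * fps_deriv (psi 0 * \<Phi> ^ n) =
      psi 1 * \<Phi> ^ n + of_nat n * (psi 0 * psi 1 * \<Phi> ^ n)"
    by (simp add: psi_1_eq_deriv[symmetric] distrib_left mult_ac del: One_nat_def)
  then have "of_nat n * (psi 0 * \<Phi> ^ n) $ n =
      (psi 1 * \<Phi> ^ n) $ n + of_nat n * (psi 0 * psi 1 * \<Phi> ^ n) $ n"
    using X_deriv_nth[of "psi 0 * \<Phi> ^ n"] by (simp flip: fps_of_nat)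
  then have "of_nat n * (psi 0 oo s) $ n = (psi 1 * \<Phi> ^ n) $ n"
    unfolding lagrange_psi[OF assms(1)] by (simp add: algebra_simps)
  also have "\<dots> = (\<Phi> ^ n) $ n"
    using lagrange_core[OF \<Phi>_inverse \<Phi>_nth_0, of n] assms(2)
    unfolding X_deriv_\<Phi>_inv by (simp add: algebra_simps)
  finally have "qconst (1 / of_nat n) * (qconst (of_nat n) * (psi 0 oo s) $ n) =
      qconst (1 / of_nat n) * (\<Phi> ^ n) $ n"
    by (simp add: qconst_of_nat)
  then show ?thesis using assms(2) by (simp flip: mult.assoc qconst_mult)
qed

text \<open>The series h of the introduction. At \<open>i = 1\<close> division by zero gives 0, so
  the linear term vanishes as it should.\<close>

definition log_kernel :: "qp fps" where
  "log_kernel = Abs_fps (\<lambda>i. if i = 0 then 1 else - qconst (1 / (of_nat i * of_nat (i - 1))))"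

text \<open>Partial fractions of 1/(n(n - 1)). The factor \<open>1 - fps_X\<close> is split off
  because it becomes the \<open>1 - psi 1\<close> of Lagrange inversion.\<close>

lemma log_kernel_eq: "log_kernel = (1 + log_inv_series) * (1 - fps_X)"
proof (rule fps_ext)
  fix n
  consider "n = 0" | "n = 1" | k where "n = Suc (Suc k)"
    by (metis One_nat_def not0_implies_Suc)
  then show "log_kernel $ n = ((1 + log_inv_series) * (1 - fps_X)) $ n"
  proof cases
    case 3
    have "- (1 / (of_nat n * of_nat (n - 1))) = 1 / of_nat n - (1 / of_nat (n - 1) :: rat)"
      using 3 by (simp add: field_simps)
    then have "- qconst (1 / (of_nat n * of_nat (n - 1))) =
        qconst (1 / of_nat n) - qconst (1 / of_nat (n - 1))"
      by (metis qconst_diff qconst_uminus)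
    then show ?thesis using 3
      by (simp add: log_kernel_def log_inv_series_def right_diff_distrib)
  qed (simp_all add: log_kernel_def log_inv_series_def right_diff_distrib)
qed

lemma fps_power_mult_power_nth_eq_0:
  fixes f g :: "'a::comm_ring_1 fps"
  assumes "f $ 0 = 0" "g $ 0 = 0" "n < i + k"
  shows "(f ^ i * g ^ k) $ n = 0"
  unfolding fps_mult_nth
proof (intro sum.neutral ballI)
  fix j assume "j \<in> {0..n}"
  then have "j < i \<or> n - j < k" using assms(3) by auto
  then show "(f ^ i) $ j * (g ^ k) $ (n - j) = 0"
    using startsby_zero_power_prefix assms(1,2) by (metis mult_zero_left mult_zero_right)
qed

text \<open>The product \<open>f ^ i * g ^ k\<close> has no terms below degree \<open>i + k\<close>,
  so the square of index pairs shrinks to a triangle. It is grouped by \<open>m = i + k\<close>,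
  which becomes the number of parts.\<close>

lemma fps_compose_mult_compose_nth:
  fixes a b f g :: "'a::comm_ring_1 fps"
  assumes "f $ 0 = 0" "g $ 0 = 0"
  shows "((a oo f) * (b oo g)) $ n =
    (\<Sum>m\<le>n. \<Sum>i\<le>m. a $ i * b $ (m - i) * (f ^ i * g ^ (m - i)) $ n)"
proof -
  let ?t = "\<lambda>i k. a $ i * b $ k * (f ^ i * g ^ k) $ n"
  have "((a oo f) * (b oo g)) $ n = (\<Sum>i\<le>n. a $ i * ((b oo g) * f ^ i) $ n)"
    by (simp add: fps_compose_mult_nth[OF assms(1)] mult.commute)
  also have "\<dots> = (\<Sum>i\<le>n. \<Sum>k\<le>n. ?t i k)"
    by (simp add: fps_compose_mult_nth[OF assms(2)] sum_distrib_left mult_ac)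
  also have "\<dots> = (\<Sum>(i, k)\<in>{..n} \<times> {..n}. ?t i k)"
    by (rule sum.cartesian_product)
  also have "\<dots> = (\<Sum>(i, k)\<in>{(i, k). i + k \<le> n}. ?t i k)"
  proof (intro sum.mono_neutral_right)
    show "\<forall>x\<in>{..n} \<times> {..n} - {(i, k). i + k \<le> n}. (case x of (i, k) \<Rightarrow> ?t i k) = 0"
    proof
      fix x assume x: "x \<in> {..n} \<times> {..n} - {(i, k). i + k \<le> n}"
      obtain i k where "x = (i, k)" by (cases x)
      then show "(case x of (i, k) \<Rightarrow> ?t i k) = 0"
        using x fps_power_mult_power_nth_eq_0[OF assms, of n i k] by simp
    qed
    show "{(i, k). i + k \<le> n} \<subseteq> {..n} \<times> {..n}" by auto
  qed simp
  also have "\<dots> = (\<Sum>m\<le>n. \<Sum>i\<le>m. ?t i (m - i))"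
    by (rule sum.triangle_reindex_eq)
  finally show ?thesis .
qed

lemma fps_prod_lessThan_nth:
  fixes a :: "nat \<Rightarrow> 'a::comm_ring_1 fps"
  assumes "m > 0"
  shows "(\<Prod>j<m. a j) $ n = (\<Sum>v\<in>natpermute n m. \<Prod>j<m. a j $ (v ! j))"
proof -
  obtain k where k: "m = Suc k" using assms by (cases m) auto
  then have "{..<m} = {0..k}" by auto
  then show ?thesis using fps_prod_nth[of a k n] k by simp
qed

text \<open>For each index set \<open>I\<close> in the elementary symmetric function, the parts at
  \<open>I\<close> turn coefficients of \<open>psi 0\<close> into those of \<open>psi 1\<close>.
  Summing over compositions gives a product that depends only on the size of
  \<open>I\<close>.\<close>

lemma sum_elem_sym:
  assumes "m > 0"
  shows "(\<Sum>c\<in>natpermute n m. of_nat (elem_sym i c) * (\<Prod>j<m. psi 0 $ (c ! j))) =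
    of_nat (m choose i) * (psi 1 ^ i * psi 0 ^ (m - i)) $ n"
proof -
  let ?S = "{I. I \<subseteq> {..<m} \<and> card I = i}"
  have weight: "of_nat (\<Prod>j\<in>I. c ! j) * (\<Prod>j<m. psi 0 $ (c ! j)) =
      (\<Prod>j<m. (if j \<in> I then psi 1 else psi 0) $ (c ! j))" if "I \<in> ?S" for I c
  proof -
    have I: "I \<subseteq> {..<m}" using that by auto
    then have "(\<Prod>j\<in>I. c ! j) = (\<Prod>j<m. if j \<in> I then c ! j else 1)"
      by (simp add: prod.If_cases Int_absorb1)
    then have "of_nat (\<Prod>j\<in>I. c ! j) * (\<Prod>j<m. psi 0 $ (c ! j)) =
        (\<Prod>j<m. of_nat (if j \<in> I then c ! j else 1) * psi 0 $ (c ! j))"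
      by (simp add: prod.distrib)
    also have "\<dots> = (\<Prod>j<m. (if j \<in> I then psi 1 else psi 0) $ (c ! j))"
      by (intro prod.cong) (simp_all add: psi_1_nth)
    finally show ?thesis .
  qed
  have power: "(\<Prod>j<m. if j \<in> I then psi 1 else psi 0) = psi 1 ^ i * psi 0 ^ (m - i)"
    if "I \<in> ?S" for I
  proof -
    have "{..<m} \<inter> I = I" "card ({..<m} \<inter> - I) = m - i"
      using that card_Diff_subset[of I "{..<m}"] finite_subset[of I "{..<m}"]
      by (auto simp: Diff_eq)
    then show ?thesis using that by (simp add: prod.If_cases)
  qed
  have "(\<Sum>c\<in>natpermute n m. of_nat (elem_sym i c) * (\<Prod>j<m. psi 0 $ (c ! j))) =
      (\<Sum>c\<in>natpermute n m. \<Sum>I\<in>?S. \<Prod>j<m. (if j \<in> I then psi 1 else psi 0) $ (c ! j))"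
  proof (intro sum.cong refl)
    fix c assume "c \<in> natpermute n m"
    then have "length c = m" by (simp add: natpermute_def)
    then have "of_nat (elem_sym i c) * (\<Prod>j<m. psi 0 $ (c ! j)) =
        (\<Sum>I\<in>?S. of_nat (\<Prod>j\<in>I. c ! j) * (\<Prod>j<m. psi 0 $ (c ! j)))"
      by (simp add: elem_sym_def sum_distrib_right)
    then show "of_nat (elem_sym i c) * (\<Prod>j<m. psi 0 $ (c ! j)) =
        (\<Sum>I\<in>?S. \<Prod>j<m. (if j \<in> I then psi 1 else psi 0) $ (c ! j))"
      by (simp only: weight cong: sum.cong)
  qed
  also have "\<dots> = (\<Sum>I\<in>?S. (\<Prod>j<m. if j \<in> I then psi 1 else psi 0) $ n)"
    by (subst sum.swap) (simp only: fps_prod_lessThan_nth[OF assms])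
  also have "\<dots> = (\<Sum>I\<in>?S. (psi 1 ^ i * psi 0 ^ (m - i)) $ n)"
    by (intro sum.cong refl arg_cong[where f = "\<lambda>F. F $ n"] power)
  also have "\<dots> = of_nat (m choose i) * (psi 1 ^ i * psi 0 ^ (m - i)) $ n"
    by (simp add: n_subsets)
  finally show ?thesis .
qed

subsection \<open>Sums over compositions\<close>

definition bracket :: "nat \<Rightarrow> nat list \<Rightarrow> rat" where
  "bracket n c = of_nat n ^ length c - of_nat n ^ (length c - 1)
     - (\<Sum>i=2..length c. fact (i - 2) * of_nat (elem_sym i c) * of_nat n ^ (length c - i))"

text \<open>The share of one rearrangement of a partition in 24 G1, with the class size already
  absorbed.\<close>

definition composition_term :: "nat \<Rightarrow> nat list \<Rightarrow> qp" where
  "composition_term n c =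
     qconst (bracket n c / fact (length c)) * (\<Prod>j<length c. psi 0 $ (c ! j))"

text \<open>Since (i - 2)! binom(m, i) / m! = 1/(i(i - 1)) * 1/(m - i)!, each subtracted term splits
  into a coefficient of \<open>log_kernel\<close> and one of the exponential.\<close>

lemma sum_composition_term:
  assumes "n > 0" "m > 0"
  shows "(\<Sum>c\<in>natpermute n m. composition_term n c) =
    (\<Sum>i\<le>m. log_kernel $ i * exp_fps (of_nat n) $ (m - i) * (psi 1 ^ i * psi 0 ^ (m - i)) $ n)
      - qconst (1 / of_nat n) * (exp_fps (of_nat n) $ m * (psi 0 ^ m) $ n)"
proof -
  let ?P = "\<lambda>c. \<Prod>j<m. psi 0 $ (c ! j)"
  let ?N = "of_nat n :: rat"
  let ?k = "\<lambda>i. fact (i - 2) * ?N ^ (m - i) / fact m"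
  let ?p = "\<lambda>i. (psi 1 ^ i * psi 0 ^ (m - i)) $ n"
  have term_eq: "composition_term n c = qconst (?N ^ m / fact m - ?N ^ (m - 1) / fact m) * ?P c -
      (\<Sum>i=2..m. qconst (?k i) * (of_nat (elem_sym i c) * ?P c))" if "c \<in> natpermute n m" for c
  proof -
    have "length c = m" using that by (simp add: natpermute_def)
    moreover have "bracket n c / fact m =
        (?N ^ m / fact m - ?N ^ (m - 1) / fact m) - (\<Sum>i=2..m. ?k i * of_nat (elem_sym i c))"
      unfolding bracket_def \<open>length c = m\<close>
      by (simp add: diff_divide_distrib sum_divide_distrib mult_ac)
    ultimately show ?thesis
      by (simp only: composition_term_def qconst_diff qconst_sum qconst_mult qconst_of_nat
          left_diff_distrib sum_distrib_right mult.assoc)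
  qed
  have power: "(\<Sum>c\<in>natpermute n m. ?P c) = ?p 0"
    using fps_prod_lessThan_nth[OF assms(2), of "\<lambda>_. psi 0" n] by simp
  have tail: "qconst (?k i) * (of_nat (m choose i) * ?p i) =
      - (log_kernel $ i * exp_fps ?N $ (m - i) * ?p i)" if "i \<in> {2..m}" for i
  proof -
    define l where "l = i - 2"
    have l: "i = Suc (Suc l)" using that unfolding l_def atLeastAtMost_iff by arith
    have "fact i = (of_nat i * of_nat (i - 1) * fact (i - 2) :: rat)"
      by (simp add: l algebra_simps)
    then have "?k i * of_nat (m choose i) = 1 / (of_nat i * of_nat (i - 1)) * (?N ^ (m - i) / fact (m - i))"
      using that l by (simp add: binomial_fact divide_simps)
    then have "qconst (?k i) * of_nat (m choose i) =
        qconst (1 / (of_nat i * of_nat (i - 1))) * qconst (?N ^ (m - i) / fact (m - i))"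
      by (metis qconst_mult qconst_of_nat)
    then show ?thesis using l by (simp add: log_kernel_def exp_fps_def flip: mult.assoc)
  qed
  have "(\<Sum>c\<in>natpermute n m. composition_term n c) =
      qconst (?N ^ m / fact m - ?N ^ (m - 1) / fact m) * ?p 0 -
      (\<Sum>i=2..m. qconst (?k i) * (of_nat (m choose i) * ?p i))"
  proof -
    have "(\<Sum>c\<in>natpermute n m. composition_term n c) =
      qconst (?N ^ m / fact m - ?N ^ (m - 1) / fact m) * (\<Sum>c\<in>natpermute n m. ?P c) -
      (\<Sum>c\<in>natpermute n m. \<Sum>i=2..m. qconst (?k i) * (of_nat (elem_sym i c) * ?P c))"
      by (simp only: term_eq sum_subtractf sum_distrib_left cong: sum.cong)
    also have "(\<Sum>c\<in>natpermute n m. \<Sum>i=2..m. qconst (?k i) * (of_nat (elem_sym i c) * ?P c)) =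
        (\<Sum>i=2..m. qconst (?k i) * (\<Sum>c\<in>natpermute n m. of_nat (elem_sym i c) * ?P c))"
      by (subst sum.swap) (simp only: sum_distrib_left)
    finally show ?thesis by (simp only: power sum_elem_sym[OF assms(2)])
  qed
  also have "(\<Sum>i=2..m. qconst (?k i) * (of_nat (m choose i) * ?p i)) =
      - (\<Sum>i=2..m. log_kernel $ i * exp_fps ?N $ (m - i) * ?p i)"
    by (simp only: tail sum_negf cong: sum.cong)
  also have "?N ^ (m - 1) / fact m = 1 / ?N * (?N ^ m / fact m)"
    using assms by (cases m) simp_all
  also have "qconst (?N ^ m / fact m - 1 / ?N * (?N ^ m / fact m)) * ?p 0 =
      exp_fps ?N $ m * ?p 0 - qconst (1 / ?N) * (exp_fps ?N $ m * ?p 0)"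
    by (simp only: qconst_diff qconst_mult exp_fps_def fps_nth_Abs_fps left_diff_distrib mult.assoc)
  also have "exp_fps ?N $ m * ?p 0 - qconst (1 / ?N) * (exp_fps ?N $ m * ?p 0) -
        - (\<Sum>i=2..m. log_kernel $ i * exp_fps ?N $ (m - i) * ?p i) =
      (\<Sum>i\<le>m. log_kernel $ i * exp_fps ?N $ (m - i) * ?p i) -
        qconst (1 / ?N) * (exp_fps ?N $ m * ?p 0)"
  proof -
    \<comment> \<open>The index 0 supplies the leading term n^m / m!, and the index 1 contributes
      nothing.\<close>
    have "{..m} = insert 0 (insert 1 {2..m})" using assms(2) by auto
    then show ?thesis by (simp add: log_kernel_def)
  qed
  finally show ?thesis by simp
qed

lemma sum_all_composition_terms:
  assumes "n > 0"
  shows "(\<Sum>m=1..n. \<Sum>c\<in>natpermute n m. composition_term n c) =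
    ((log_kernel oo psi 1) * \<Phi> ^ n) $ n - qconst (1 / of_nat n) * (\<Phi> ^ n) $ n"
proof -
  \<comment> \<open>The index \<open>m = 0\<close> belongs to a constant series, whose coefficient
    at \<open>n > 0\<close> is zero.\<close>
  have split0: "{..n} = insert 0 {1..n}" by auto
  have "((log_kernel oo psi 1) * \<Phi> ^ n) $ n =
    (\<Sum>m=1..n. \<Sum>i\<le>m. log_kernel $ i * exp_fps (of_nat n) $ (m - i) * (psi 1 ^ i * psi 0 ^ (m - i)) $ n)"
    unfolding \<Phi>_power using assms
    by (subst fps_compose_mult_compose_nth) (simp_all add: split0)
  moreover have "(\<Phi> ^ n) $ n = (\<Sum>m=1..n. exp_fps (of_nat n) $ m * (psi 0 ^ m) $ n)"
    unfolding \<Phi>_power fps_compose_nth atLeast0AtMost using assms by (simp add: split0)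
  ultimately show ?thesis
    using assms by (simp add: sum_composition_term sum_subtractf sum_distrib_left)
qed

section \<open>Passage from partitions to compositions\<close>

lemma elem_sym_cong_mset:
  assumes "mset xs = mset ys"
  shows "elem_sym i xs = elem_sym i ys"
proof -
  obtain p where p: "p permutes {..<length ys}" "permute_list p ys = xs"
    using mset_eq_permutation[OF assms] .
  let ?S = "{I. I \<subseteq> {..<length ys} \<and> card I = i}"
  have len: "length xs = length ys" using assms by (rule mset_eq_length)
  have inj: "inj_on p A" for A using permutes_inj[OF p(1)] by (simp add: inj_on_def inj_def)
  have bij: "bij_betw ((`) p) ?S ?S"
  proof (rule bij_betw_imageI)
    show "inj_on ((`) p) ?S" using permutes_inj[OF p(1)] by (simp add: inj_on_def inj_image_eq_iff)
    have im: "q ` I \<in> ?S" if "q permutes {..<length ys}" "I \<in> ?S" for q I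
      using that permutes_image[OF that(1)] permutes_inj_on[OF that(1)] by (auto simp: card_image)
    show "(`) p ` ?S = ?S"
    proof
      show "(`) p ` ?S \<subseteq> ?S" using im[OF p(1)] by blast
      show "?S \<subseteq> (`) p ` ?S"
      proof
        fix I assume I: "I \<in> ?S"
        have "I = p ` (inv p ` I)"
          using permutes_inverses(1)[OF p(1)] by (simp add: image_image)
        moreover have "inv p ` I \<in> ?S" using im[OF permutes_inv[OF p(1)] I] .
        ultimately show "I \<in> (`) p ` ?S" by blast
      qed
    qed
  qed
  have "elem_sym i ys = (\<Sum>I\<in>?S. \<Prod>j\<in>p ` I. ys ! j)"
    unfolding elem_sym_def by (rule sum.reindex_bij_betw[OF bij, symmetric])
  also have "\<dots> = (\<Sum>I\<in>?S. \<Prod>j\<in>I. xs ! j)"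
  proof (intro sum.cong refl)
    fix I assume "I \<in> ?S"
    then have "xs ! j = ys ! p j" if "j \<in> I" for j
      using that permute_list_nth[OF p(1), of j] p(2) by auto
    then show "(\<Prod>j\<in>p ` I. ys ! j) = (\<Prod>j\<in>I. xs ! j)"
      by (simp add: prod.reindex[OF inj])
  qed
  finally show ?thesis by (simp add: elem_sym_def len)
qed

lemma prod_nth_eq_prod_mset: "(\<Prod>j<length xs. f (xs ! j)) = (\<Prod>x\<in>#mset xs. f x)"
  by (induction xs) (simp_all add: prod.lessThan_Suc_shift del: prod.lessThan_Suc)

lemma composition_term_cong_mset:
  assumes "mset xs = mset ys"
  shows "composition_term n xs = composition_term n ys"
proof -
  have "length xs = length ys" using assms by (rule mset_eq_length)
  then have "bracket n xs = bracket n ys"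
    unfolding bracket_def using elem_sym_cong_mset[OF assms] by simp
  then show ?thesis
    using assms \<open>length xs = length ys\<close>
    unfolding composition_term_def prod_nth_eq_prod_mset by simp
qed

text \<open>The centralizer order and the count of rearrangements share the product
  \<open>?F\<close> of multiplicity factorials; eliminating it crosswise avoids division.\<close>

lemma card_conj_class:
  assumes "0 \<notin> set \<alpha>"
  shows "card (conj_class \<alpha>) * prod_list \<alpha> * fact (length \<alpha>) =
    card (permutations_of_multiset (mset \<alpha>)) * fact (sum_list \<alpha>)"
proof -
  let ?F = "\<Prod>k\<in>set_mset (mset \<alpha>). fact (count (mset \<alpha>) k) :: nat"
  have "conj_class \<alpha> = {p. p permutes {1..sum_list \<alpha>} \<and> cycle_mset p {1..sum_list \<alpha>} = mset \<alpha>}"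
    by (simp add: conj_class_def cycle_type_def cycle_mset_def)
  then have "fact (sum_list \<alpha>) = card (conj_class \<alpha>) * (prod_list \<alpha> * ?F)"
    using card_cycle_mset[of "{1..sum_list \<alpha>}" "mset \<alpha>"] assms
    by (simp add: cycle_weight_def prod_mset_prod_list sum_mset_sum_list)
  moreover have "fact (length \<alpha>) = card (permutations_of_multiset (mset \<alpha>)) * ?F"
    using card_permutations_of_multiset_aux[of "mset \<alpha>"] by simp
  ultimately show ?thesis by (simp only: mult_ac)
qed

text \<open>Dividing each \<open>a_coeff\<close> by its part yields the coefficients of
  \<open>psi 0\<close> and releases the product of the parts that \<open>card_conj_class\<close>
  needs.\<close>

lemma G1_term_eq:
  assumes "is_partition \<alpha> n"
  shows "qconst (G1_term n \<alpha>) * p_part \<alpha> =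
    of_nat (card (permutations_of_multiset (mset \<alpha>))) * composition_term n \<alpha>"
proof -
  let ?m = "length \<alpha>"
  have pos: "0 \<notin> set \<alpha>" and n: "sum_list \<alpha> = n" using assms by (auto simp: is_partition_def)
  have pos': "\<alpha> ! j > 0" if "j < ?m" for j using that pos by (metis nth_mem gr0I)
  have "of_nat (card (conj_class \<alpha>) * prod_list \<alpha> * fact ?m) =
      (of_nat (card (permutations_of_multiset (mset \<alpha>)) * fact n) :: rat)"
    using card_conj_class[OF pos] n by simp
  then have card: "of_nat (card (conj_class \<alpha>)) * of_nat (prod_list \<alpha>) / fact n =
      (of_nat (card (permutations_of_multiset (mset \<alpha>))) / fact ?m :: rat)"
    by (simp add: field_simps)
  have "(\<Prod>j<?m. a_coeff (\<alpha> ! j)) =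
      of_nat (prod_list \<alpha>) * (\<Prod>j<?m. a_coeff (\<alpha> ! j) / of_nat (\<alpha> ! j))"
    using pos' by (simp add: prod.list_conv_set_nth atLeast0LessThan flip: prod.distrib)
  moreover have "G1_term n \<alpha> =
      of_nat (card (conj_class \<alpha>)) / fact n * (\<Prod>j<?m. a_coeff (\<alpha> ! j)) * bracket n \<alpha>"
    by (simp add: G1_term_def Let_def bracket_def a_coeff_def)
  ultimately have "G1_term n \<alpha> = of_nat (card (conj_class \<alpha>)) * of_nat (prod_list \<alpha>) / fact n
      * (bracket n \<alpha> * (\<Prod>j<?m. a_coeff (\<alpha> ! j) / of_nat (\<alpha> ! j)))"
    by simp
  also have "\<dots> = of_nat (card (permutations_of_multiset (mset \<alpha>))) * (bracket n \<alpha> / fact ?m)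
      * (\<Prod>j<?m. a_coeff (\<alpha> ! j) / of_nat (\<alpha> ! j))"
    unfolding card by simp
  finally have "qconst (G1_term n \<alpha>) * p_part \<alpha> =
      of_nat (card (permutations_of_multiset (mset \<alpha>))) * (qconst (bracket n \<alpha> / fact ?m) *
      (\<Prod>j<?m. qconst (a_coeff (\<alpha> ! j) / of_nat (\<alpha> ! j)) * pvar (\<alpha> ! j)))"
    by (simp only: qconst_mult qconst_of_nat qconst_prod p_part_def prod.distrib mult.assoc)
  also have "(\<Prod>j<?m. qconst (a_coeff (\<alpha> ! j) / of_nat (\<alpha> ! j)) * pvar (\<alpha> ! j)) =
      (\<Prod>j<?m. psi 0 $ (\<alpha> ! j))"
    using pos' by (intro prod.cong) (simp_all add: psi_0_nth)
  finally show ?thesis by (simp add: composition_term_def)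
qed

text \<open>Compositions with positive parts are grouped by their decreasing rearrangement; the
  fibre over a partition consists of all its rearrangements, which share one value of
  \<open>composition_term\<close>.\<close>

lemma G1_nth:
  "G1 $ n = qconst (1 / 24) * (\<Sum>m=1..n. \<Sum>c\<in>natpermute n m. composition_term n c)"
proof -
  let ?T = "{\<alpha>. is_partition \<alpha> n \<and> length \<alpha> \<ge> 1}"
  let ?C = "\<lambda>m. {c \<in> natpermute n m. 0 \<notin> set c}"
  define S where "S = (\<Union>m\<in>{1..n}. ?C m)"
  let ?g = "\<lambda>c :: nat list. rev (sort c)"
  have S: "c \<in> S \<longleftrightarrow> c \<noteq> [] \<and> sum_list c = n \<and> 0 \<notin> set c" for c
  proof -
    have "length c \<le> sum_list c" if "0 \<notin> set c"
      using that by (induction c) auto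
    then show ?thesis by (cases c) (auto simp: S_def natpermute_def)
  qed
  have sort_iff: "rev (sort c) = \<alpha> \<longleftrightarrow> mset c = mset \<alpha>" if "\<alpha> \<in> ?T" for c \<alpha>
  proof
    assume "mset c = mset \<alpha>"
    moreover have "sorted (rev \<alpha>)"
      using that by (simp add: is_partition_def sorted_wrt_rev)
    ultimately have "sort c = rev \<alpha>" by (intro properties_for_sort) simp_all
    then show "rev (sort c) = \<alpha>" by simp
  qed auto
  have mset_S: "c \<in> S" if "\<alpha> \<in> ?T" "mset c = mset \<alpha>" for c \<alpha>
  proof -
    have "sum_list c = sum_list \<alpha>" using that(2) by (metis sum_mset_sum_list)
    moreover have "set c = set \<alpha>" using that(2) by (metis set_mset_mset)
    ultimately show ?thesis using that(1) unfolding S is_partition_def by auto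
  qed
  have finS: "finite S" by (simp add: S_def natpermute_finite)
  have gT: "?g ` S \<subseteq> ?T"
  proof
    fix \<alpha> assume "\<alpha> \<in> ?g ` S"
    then obtain c where c: "\<alpha> = ?g c" "c \<in> S" by (rule imageE)
    have "sum_list (sort c) = sum_list c" by (metis mset_sort sum_mset_sum_list)
    moreover have "sort c = [] \<longleftrightarrow> c = []" by (metis set_empty set_sort)
    ultimately show "\<alpha> \<in> ?T" using c(2) unfolding c(1) S is_partition_def
      by (auto simp: sorted_wrt_rev Suc_le_eq intro: gr0I)
  qed
  have "(\<Sum>\<alpha>\<in>?T. qconst (G1_term n \<alpha>) * p_part \<alpha>) =
      (\<Sum>\<alpha>\<in>?T. \<Sum>c\<in>{c \<in> S. ?g c = \<alpha>}. composition_term n c)"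
  proof (intro sum.cong refl)
    fix \<alpha> assume \<alpha>: "\<alpha> \<in> ?T"
    have "{c \<in> S. ?g c = \<alpha>} = permutations_of_multiset (mset \<alpha>)"
      using sort_iff[OF \<alpha>] mset_S[OF \<alpha>] by (auto simp: permutations_of_multiset_def)
    then have "(\<Sum>c\<in>{c \<in> S. ?g c = \<alpha>}. composition_term n c) =
        (\<Sum>c\<in>permutations_of_multiset (mset \<alpha>). composition_term n \<alpha>)"
      by (intro sum.cong) (auto dest: permutations_of_multisetD intro: composition_term_cong_mset)
    also have "\<dots> = qconst (G1_term n \<alpha>) * p_part \<alpha>"
      using G1_term_eq[of \<alpha> n] \<alpha> by simp
    finally show "qconst (G1_term n \<alpha>) * p_part \<alpha> =
        (\<Sum>c\<in>{c \<in> S. ?g c = \<alpha>}. composition_term n c)" by simp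
  qed
  also have "\<dots> = (\<Sum>c\<in>S. composition_term n c)"
    using finS finite_partitions gT by (rule sum.group)
  also have "\<dots> = (\<Sum>m=1..n. \<Sum>c\<in>?C m. composition_term n c)"
    unfolding S_def by (intro sum.UNION_disjoint) (auto simp: natpermute_finite, auto simp: natpermute_def)
  \<comment> \<open>\<open>natpermute\<close> also allows zero parts; these lists add nothing
    because \<open>psi 0\<close> has zero constant term.\<close>
  also have "\<dots> = (\<Sum>m=1..n. \<Sum>c\<in>natpermute n m. composition_term n c)"
  proof (rule sum.cong[OF refl], rule sum.mono_neutral_left)
    fix m
    show "finite (natpermute n m)" by (rule natpermute_finite)
    show "\<forall>c\<in>natpermute n m - ?C m. composition_term n c = 0"
    proof
      fix c assume "c \<in> natpermute n m - ?C m"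
      then obtain j where "j < length c" "c ! j = 0" by (auto simp: in_set_conv_nth)
      then have "(\<Prod>j<length c. psi 0 $ (c ! j)) = 0"
        by (intro prod_zero) (auto intro: bexI[of _ j])
      then show "composition_term n c = 0" by (simp add: composition_term_def)
    qed
  qed auto
  finally show ?thesis by (simp add: G1_def)
qed

theorem theorem4p2:
  shows "(\<exists>!s. solves_functional_eq s) \<and>
    (\<forall>s. solves_functional_eq s \<longrightarrow>
       G1 = fps_const (qconst (1 / 24)) * (log_inv_series oo (psi 1 oo s))
            - fps_const (qconst (1 / 24)) * (psi 0 oo s))"
proof (intro conjI allI impI)
  show "\<exists>!s. solves_functional_eq s"
    unfolding solves_functional_eq_iff by (rule functional_equation_ex1[OF \<Phi>_inverse \<Phi>_nth_0])
  fix s assume s: "solves_functional_eq s"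
  then have s0: "s $ 0 = 0" by (subst (asm) solves_functional_eq_def) (erule ssubst, simp)
  let ?L = "log_inv_series oo psi 1"
  have kernel: "log_kernel oo psi 1 = (1 + ?L) * (1 - psi 1)"
    unfolding log_kernel_eq
    by (simp add: fps_compose_mult_distrib fps_compose_add_distrib fps_compose_sub_distrib del: One_nat_def)
  show "G1 = fps_const (qconst (1 / 24)) * (log_inv_series oo (psi 1 oo s))
            - fps_const (qconst (1 / 24)) * (psi 0 oo s)"
  proof (rule fps_ext)
    fix n
    show "G1 $ n = (fps_const (qconst (1 / 24)) * (log_inv_series oo (psi 1 oo s))
            - fps_const (qconst (1 / 24)) * (psi 0 oo s)) $ n"
    proof (cases "n = 0")
      case True
      then show ?thesis by (simp add: G1_nth log_inv_series_def)
    next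
      case False
      then have n: "n > 0" by simp
      \<comment> \<open>The factor \<open>1 - psi 1\<close> in \<open>kernel\<close> is the one that
        Lagrange inversion absorbs; the summand 1 then disappears because
        \<open>n > 0\<close>.\<close>
      have "((log_kernel oo psi 1) * \<Phi> ^ n) $ n = ((1 + ?L) oo s) $ n"
        unfolding kernel by (rule lagrange_psi[OF s, symmetric])
      also have "\<dots> = (log_inv_series oo (psi 1 oo s)) $ n"
        using n s0 by (simp add: fps_compose_add_distrib fps_compose_assoc)
      finally show ?thesis
        unfolding G1_nth sum_all_composition_terms[OF n]
        by (simp add: psi_0_compose_nth[OF s n] right_diff_distrib)
    qed
  qed
qed

end
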